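(* Let $K\ge 1$ and $N\ge 1$ be integers, let $\gamma>0$, let $c>0$ and $M>0$ be respectively the per-step back-propagation cost and the number of sample trajectories of the brute-force policy gradient method (PGM) with $N^K$ time steps, and for $k\in\{1,\dots,K\}$ let $c_k>0$, $M_k>0$ and $I_k\in(0,1]$ (with $I_1=1$) be the per-step back-propagation cost, the number of samples per interval, and the ratio of refined intervals at stage $k$ of the $K$-fold hierarchical PGM with $N^K$ time steps. Put $$a_k:=\frac{c_kM_kI_k}{cM},\qquad k\in\{1,\dots,K\}.$$ Suppose that there are real numbers $g_1,\dots,g_K$ with $$0<\frac{g_1}{N^{K-1}}<\frac{g_2}{N^{K-2}}<\cdots<\frac{g_{K-1}}{N}<g_K=\frac1\gamma$$ such that, with the convention $g_0:=0$, $$a_k=g_k-\frac{g_{k-1}}{N}\quad\text{for all }k\in\{1,\dots,K\}$$ (in particular $a_K=\frac1\gamma-\frac{g_{K-1}}{N}$). Then the $K$-fold hierarchical PGM is $\gamma$ times more efficient than the brute-force PGM with the same number $N^K$ of time steps, i.e. their computational costs satisfy $$\mathrm{Cost}_{\mathrm{hier}}=\frac1\gamma\,\mathrm{Cost}_{\mathrm{bf}},$$ where $\mathrm{Cost}_{\mathrm{hier}}=\sum_{k=1}^{K}c_kM_kI_kN^k$ and $\mathrm{Cost}_{\mathrm{bf}}=c\,M\,N^K$.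
   Context: The policy gradient method (PGM) for a stochastic optimal control problem on $[0,T]$, discretized in time with $n$ steps, models the control by a neural network and minimizes by gradient descent the empirical cost over sample trajectories. The computational cost is measured by the number of operations of one back-propagation: with $n$ time steps, $M$ sample trajectories, and a network whose architecture imposes a cost $c$ per time step and per trajectory, it is $c\,n\,M$. Brute-force PGM: the PGM applied directly with $n=N^K$ time steps over the whole horizon and $M$ samples, with architecture cost $c$; its cost is $\mathrm{Cost}_{\mathrm{bf}}=c\,M\,N^K$. $K$-fold hierarchical PGM: there are stages $k=1,\dots,K$, and stage $k$ has the time grid of $[0,T]$ with $N_k=N^k$ equal steps. Stage $1$ solves the problem with $N$ time steps using $M_1$ samples (and $I_1=1$ always). At stage $k+1$, a fraction $I_{k+1}$ of the $N^k$ intervals of the stage-$k$ grid is selected; each selected interval is subdivided into $N$ equal steps and $M_{k+1}$ sample trajectories are used on each selected interval to train a new policy network. The constant $c_k$ is the cost of back-propagation per time step and per trajectory at stage $k$ (for both policy and value-function surrogate training), which depends on the network architecture. Thus the cost of stage $k$ is $c_kM_kI_kN^k$, and the total cost is $\mathrm{Cost}_{\mathrm{hier}}=\sum_{k=1}^{K}c_kM_kI_kN^k$. "$\gamma$ times more efficient" means that the ratio of the cost of the hierarchical PGM to the cost of the brute-force PGM equals $1/\gamma$. *)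

theory Defs
  imports Complex_Main
begin

text \<open>
  Sequences indexed by the stages \<open>1, \<dots>, K\<close> are functions on \<^typ>\<open>nat\<close> of which only the
  values at these indices matter.  Costs per step and sample numbers are positive reals.
\<close>

definition backprop_cost :: "real \<Rightarrow> real \<Rightarrow> real \<Rightarrow> real" where
  "backprop_cost c n M = c * n * M"

definition cost_bf :: "nat \<Rightarrow> nat \<Rightarrow> real \<Rightarrow> real \<Rightarrow> real" where
  "cost_bf N K c M = backprop_cost c (real N ^ K) M"

definition stage_cost ::
  "nat \<Rightarrow> (nat \<Rightarrow> real) \<Rightarrow> (nat \<Rightarrow> real) \<Rightarrow> (nat \<Rightarrow> real) \<Rightarrow> nat \<Rightarrow> real" where
  "stage_cost N cs Ms I k = cs k * Ms k * I k * real N ^ k"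

text \<open>
  At stage \<open>k\<close> a fraction \<open>I k\<close> of the \<open>N ^ (k - 1)\<close> intervals of the previous grid (the whole
  horizon if \<open>k = 1\<close>) is selected, and a network is trained with \<open>N\<close> time steps on each.
\<close>

lemma stage_cost_eq_selected_intervals:
  assumes "k \<ge> 1"
  shows "stage_cost N cs Ms I k =
    (I k * real N ^ (k - 1)) * backprop_cost (cs k) (real N) (Ms k)"
  using assms by (cases k) (simp_all add: stage_cost_def backprop_cost_def)

definition cost_hier ::
  "nat \<Rightarrow> nat \<Rightarrow> (nat \<Rightarrow> real) \<Rightarrow> (nat \<Rightarrow> real) \<Rightarrow> (nat \<Rightarrow> real) \<Rightarrow> real" where
  "cost_hier N K cs Ms I = (\<Sum>k = 1..K. stage_cost N cs Ms I k)"

text \<open>A method of cost \<open>C\<close> compared with one of cost \<open>C'\<close>.\<close>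

definition times_more_efficient :: "real \<Rightarrow> real \<Rightarrow> real \<Rightarrow> bool" where
  "times_more_efficient \<gamma> C C' \<longleftrightarrow> C / C' = 1 / \<gamma>"

end

theory Submission imports Defs begin

text \<open>
  In units of \<open>c * M\<close>, stage \<open>k\<close> costs \<open>a k * N ^ k = g k * N ^ k - g (k - 1) * N ^ (k - 1)\<close>, so the
  total cost telescopes to \<open>g K * N ^ K\<close>.
\<close>

lemma stage_cost_eq_diff:
  fixes N k :: nat and b :: real
  assumes "k \<ge> 1" and "N \<ge> 1" and "b \<noteq> 0"
    and "cs k * Ms k * I k / b = g k - g (k - 1) / real N"
  shows "stage_cost N cs Ms I k = b * (g k * real N ^ k - g (k - 1) * real N ^ (k - 1))"
proof -
  \<comment> \<open>With \<open>k = Suc j\<close> the truncated \<open>k - 1\<close> becomes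
    \<open>j\<close> and \<open>real N ^ k\<close> shows a factor \<open>real N\<close>. That factor
    cancels the division of \<open>g (k - 1)\<close> by \<open>real N\<close>, as \<open>N\<close>
    is nonzero.\<close>
  obtain j where k: "k = Suc j"
    using assms(1) by (cases k) auto
  have "cs k * Ms k * I k = b * (g k - g (k - 1) / real N)"
    using assms(3,4) by (simp add: divide_eq_eq mult.commute)
  then have "stage_cost N cs Ms I k = b * (g k - g (k - 1) / real N) * real N ^ k"
    by (simp add: stage_cost_def)
  also have "\<dots> = b * (g k * real N ^ k - g (k - 1) * real N ^ (k - 1))"
    using assms(2) by (simp add: k field_simps)
  finally show ?thesis .
qed

theorem theorem3p1:
  fixes K N :: nat and \<gamma> c M :: real and cs Ms I a g :: "nat \<Rightarrow> real"
  assumes "K \<ge> 1" and "N \<ge> 1"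
    and "\<gamma> > 0" and "c > 0" and "M > 0"
    and "\<And>k. k \<in> {1..K} \<Longrightarrow> cs k > 0"
    and "\<And>k. k \<in> {1..K} \<Longrightarrow> Ms k > 0"
    and "\<And>k. k \<in> {1..K} \<Longrightarrow> I k \<in> {0<..1}"
    and "I 1 = 1"
    and "\<And>k. k \<in> {1..K} \<Longrightarrow> a k = cs k * Ms k * I k / (c * M)"
    and "0 < g 1 / real N ^ (K - 1)"
    and "\<And>k. k \<in> {1..<K} \<Longrightarrow>
           g k / real N ^ (K - k) < g (k + 1) / real N ^ (K - (k + 1))"
    and "g K = 1 / \<gamma>"
    and "g 0 = 0"
    and "\<And>k. k \<in> {1..K} \<Longrightarrow> a k = g k - g (k - 1) / real N"
  shows "times_more_efficient \<gamma> (cost_hier N K cs Ms I) (cost_bf N K c M)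
    \<and> cost_hier N K cs Ms I = 1 / \<gamma> * cost_bf N K c M"
proof -
  define b where "b = c * M"
  have b: "b > 0"
    using assms(4,5) by (simp add: b_def)
  have "cost_hier N K cs Ms I
      = (\<Sum>k = 1..K. b * (g k * real N ^ k - g (k - 1) * real N ^ (k - 1)))"
    unfolding cost_hier_def
  proof (rule sum.cong [OF refl])
    fix k
    assume k: "k \<in> {1..K}"
    \<comment> \<open>Equating the two expressions for \<open>a k\<close> eliminates it.\<close>
    then have "cs k * Ms k * I k / b = g k - g (k - 1) / real N"
      using assms(10,15) [OF k] by (simp add: b_def)
    then show "stage_cost N cs Ms I k
        = b * (g k * real N ^ k - g (k - 1) * real N ^ (k - 1))"
      using k b \<open>N \<ge> 1\<close> by (intro stage_cost_eq_diff) auto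
  qed
  \<comment> \<open>The lower bound is written \<open>Suc 0\<close> to match the shape of the sum in
    \<open>sum_telescope''\<close>. The boundary term left at index 0 then vanishes by the
    convention \<open>g 0 = 0\<close>.\<close>
  also have "\<dots> = b * (\<Sum>k = Suc 0..K. g k * real N ^ k - g (k - 1) * real N ^ (k - 1))"
    by (simp add: sum_distrib_left)
  also have "\<dots> = b * (g K * real N ^ K - g 0 * real N ^ 0)"
    by (subst sum_telescope'') auto
  also have "\<dots> = 1 / \<gamma> * cost_bf N K c M"
    using \<open>g K = 1 / \<gamma>\<close> \<open>g 0 = 0\<close> by (simp add: b_def cost_bf_def backprop_cost_def)
  finally have eq: "cost_hier N K cs Ms I = 1 / \<gamma> * cost_bf N K c M" .
  \<comment> \<open>Passing from the product form to the ratio requires a nonzero denominator: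
    division by zero yields 0, whereas 1 / \<gamma> is positive.\<close>
  have "cost_bf N K c M > 0"
    using assms(2,4,5) by (simp add: cost_bf_def backprop_cost_def)
  then show ?thesis
    using eq by (simp add: times_more_efficient_def)
qed

end
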